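(* Let $X\neq\{\theta\}$ and $Y$ be Banach spaces, $\mathbb{N}'\subset\mathbb{N}$ infinite, and let $(A_n)_{n\in\mathbb{N}'}$ be a sequence of strictly singular operators, $A_n\in\mathcal{SS}(X,Y)$ for all $n\in\mathbb{N}'$. Then $\mathcal{SS}\lambda_{\mathbb{N}'}[A_n,\theta]=0$, where $\theta$ is the null operator from $X$ to $Y$.
   Context: Conventions: $\mathbb{N}'$ is an infinite subset of $\mathbb{N}$, $\mathbb{N}''$ an infinite subset of $\mathbb{N}'$, $\mathbb{N}'''$ an infinite subset of $\mathbb{N}''$, etc.; limits are taken along these index sets. $\theta$ denotes the null element of a Banach space and also the null operator. $\mathcal{B}(X,Y)$ is the space of bounded linear operators defined on all of $X$. $A\in\mathcal{B}(X,Y)$ is strictly singular, $A\in\mathcal{SS}(X,Y)$, if for every $\varepsilon>0$ and every closed subspace $Z\subset X$ with $\dim Z=\infty$ there exists $z\in Z$ with $\|Az\|<\varepsilon\|z\|$. Uniform $\lambda$-adjustment. Let $(M_n)_{\mathbb{N}'}$, $(P_n)_{\mathbb{N}'}$ be sequences of closed subspaces of a Banach space $E$ with $M_n\neq\{\theta\}$ for all $n$, and let $\lambda\ge 0$. $(M_n)_{\mathbb{N}'}$ is lower uniformly $\lambda$-adjusted with $(P_n)_{\mathbb{N}'}$ if for every $\eta>0$, every infinite $\mathbb{N}''\subset\mathbb{N}'$ and all unit vectors $x_n\in M_n$ ($n\in\mathbb{N}''$), there exist an infinite $\mathbb{N}'''\subset\mathbb{N}''$, vectors $y_n\in P_n$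 ($n\in\mathbb{N}'''$) and a vector $z\in E$ such that $\varlimsup_{n\in\mathbb{N}'''}\|x_n-y_n-z\|\le\lambda+\eta$. $\lambda_{\mathbb{N}'}[M_n,P_n]$ is the infimum of all such $\lambda$. Strictly singular uniform $\lambda$-adjustment. For the same data, $\mathcal{SS}\lambda_{\mathbb{N}'}[M_n,P_n]$ is the infimum of all $\lambda\ge0$ such that: for every infinite $\mathbb{N}''\subset\mathbb{N}'$ and all closed subspaces $K_n\subset M_n$ with $\dim K_n=\infty$ ($n\in\mathbb{N}''$), there exist an infinite $\mathbb{N}'''\subset\mathbb{N}''$ and closed subspaces $L_n\subset K_n$ with $\dim L_n=\infty$ ($n\in\mathbb{N}'''$) such that $\lambda_{\mathbb{N}'''}[L_n,P_n]\le\lambda$. For operators, $\mathcal{SS}\lambda_{\mathbb{N}'}[A_n,B_n]:=\mathcal{SS}\lambda_{\mathbb{N}'}[G_{A_n},G_{B_n}]$, where $G_A=\{(x,Ax)\mid x\in X\}\subset X\times Y$ is the graph and $X\times Y$ carries the norm $\max\{\|x\|,\|y\|\}$; if $B_n=B$ for all $n$ one writes $B$ in place of $B_n$. *)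

theory Defs
  imports "HOL-Analysis.Analysis"
begin

text \<open>
  The class \<^class>\<open>banach\<close> only knows real scalars.  To cover real and complex Banach spaces
  at once, the scalar multiplication is an explicit parameter.  Up to isometric isomorphism,
  the types of sort \<open>{real_normed_field, euclidean_space}\<close> are exactly
  \<^typ>\<open>real\<close> and \<^typ>\<open>complex\<close>.  A Banach space over such a field is then a type of class
  \<^class>\<open>banach\<close> with a scalar multiplication satisfying the following locale;
  \<open>smul = scaleR\<close> is the real case.
\<close>

locale normed_scaling = vector_space smul
  for smul :: "'k :: {real_normed_field, euclidean_space} \<Rightarrow> 'e :: real_normed_vector \<Rightarrow> 'e" +
  assumes norm_smul: "norm (smul c x) = norm c * norm x"
    and smul_of_real: "smul (of_real r) x = r *\<^sub>R x"

lemma normed_scaling_scaleR: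
  "normed_scaling (scaleR :: real \<Rightarrow> 'e \<Rightarrow> 'e :: real_normed_vector)"
  by unfold_locales (simp_all add: algebra_simps)

lemma normed_scaling_complex: "normed_scaling ((*) :: complex \<Rightarrow> complex \<Rightarrow> complex)"
  by unfold_locales (simp_all add: algebra_simps norm_mult scaleR_conv_of_real)

definition closed_subspace ::
  "('k :: field \<Rightarrow> 'e :: real_normed_vector \<Rightarrow> 'e) \<Rightarrow> 'e set \<Rightarrow> bool" where
  "closed_subspace smul S \<longleftrightarrow> module.subspace smul S \<and> closed S"

definition infinite_dimensional ::
  "('k :: field \<Rightarrow> 'e :: ab_group_add \<Rightarrow> 'e) \<Rightarrow> 'e set \<Rightarrow> bool" where
  "infinite_dimensional smul S \<longleftrightarrow> \<not> (\<exists>B. finite B \<and> S \<subseteq> module.span smul B)"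

definition bounded_operator ::
  "('k :: field \<Rightarrow> 'x :: real_normed_vector \<Rightarrow> 'x) \<Rightarrow> ('k \<Rightarrow> 'y :: real_normed_vector \<Rightarrow> 'y) \<Rightarrow>
    ('x \<Rightarrow> 'y) \<Rightarrow> bool" where
  "bounded_operator scaleX scaleY A \<longleftrightarrow>
    Vector_Spaces.linear scaleX scaleY A \<and> (\<exists>C. \<forall>x. norm (A x) \<le> C * norm x)"

definition strictly_singular ::
  "('k :: field \<Rightarrow> 'x :: real_normed_vector \<Rightarrow> 'x) \<Rightarrow> ('k \<Rightarrow> 'y :: real_normed_vector \<Rightarrow> 'y) \<Rightarrow>
    ('x \<Rightarrow> 'y) \<Rightarrow> bool" where
  "strictly_singular scaleX scaleY A \<longleftrightarrow>
    bounded_operator scaleX scaleY A \<and>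
    (\<forall>\<epsilon>>0. \<forall>Z. closed_subspace scaleX Z \<and> infinite_dimensional scaleX Z \<longrightarrow>
      (\<exists>z\<in>Z. norm (A z) < \<epsilon> * norm z))"


text \<open>
  A sequence indexed by an infinite set \<open>N\<close> of natural numbers is a function on
  \<^typ>\<open>nat\<close> of which only the values on \<open>N\<close> are used.
\<close>

definition limsup_on :: "nat set \<Rightarrow> (nat \<Rightarrow> real) \<Rightarrow> ereal" where
  "limsup_on N a = Limsup (inf sequentially (principal N)) (\<lambda>n. ereal (a n))"

definition lower_uniformly_adjusted ::
  "nat set \<Rightarrow> (nat \<Rightarrow> 'e :: real_normed_vector set) \<Rightarrow> (nat \<Rightarrow> 'e set) \<Rightarrow> real \<Rightarrow> bool" where
  "lower_uniformly_adjusted N M P l \<longleftrightarrow>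
    (\<forall>\<eta>>0. \<forall>N2 x. N2 \<subseteq> N \<and> infinite N2 \<and> (\<forall>n\<in>N2. x n \<in> M n \<and> norm (x n) = 1) \<longrightarrow>
      (\<exists>N3 y z. N3 \<subseteq> N2 \<and> infinite N3 \<and> (\<forall>n\<in>N3. y n \<in> P n) \<and>
        limsup_on N3 (\<lambda>n. norm (x n - y n - z)) \<le> ereal (l + \<eta>)))"

definition uniform_adjustment ::
  "nat set \<Rightarrow> (nat \<Rightarrow> 'e :: real_normed_vector set) \<Rightarrow> (nat \<Rightarrow> 'e set) \<Rightarrow> real" where
  "uniform_adjustment N M P = Inf {l. 0 \<le> l \<and> lower_uniformly_adjusted N M P l}"

definition ss_adjusted ::
  "('k :: field \<Rightarrow> 'e :: real_normed_vector \<Rightarrow> 'e) \<Rightarrow>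
    nat set \<Rightarrow> (nat \<Rightarrow> 'e set) \<Rightarrow> (nat \<Rightarrow> 'e set) \<Rightarrow> real \<Rightarrow> bool" where
  "ss_adjusted smul N M P l \<longleftrightarrow>
    (\<forall>N2 K. N2 \<subseteq> N \<and> infinite N2 \<and>
        (\<forall>n\<in>N2. closed_subspace smul (K n) \<and> K n \<subseteq> M n \<and> infinite_dimensional smul (K n)) \<longrightarrow>
      (\<exists>N3 L. N3 \<subseteq> N2 \<and> infinite N3 \<and>
        (\<forall>n\<in>N3. closed_subspace smul (L n) \<and> L n \<subseteq> K n \<and> infinite_dimensional smul (L n)) \<and>
        uniform_adjustment N3 L P \<le> l))"

definition ss_uniform_adjustment ::
  "('k :: field \<Rightarrow> 'e :: real_normed_vector \<Rightarrow> 'e) \<Rightarrow>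
    nat set \<Rightarrow> (nat \<Rightarrow> 'e set) \<Rightarrow> (nat \<Rightarrow> 'e set) \<Rightarrow> real" where
  "ss_uniform_adjustment smul N M P = Inf {l. 0 \<le> l \<and> ss_adjusted smul N M P l}"

text \<open>
  The real infima above are never taken over an empty set: the value \<open>1\<close> always qualifies.
\<close>

lemma lower_uniformly_adjusted_1:
  assumes "\<And>n. n \<in> N \<Longrightarrow> 0 \<in> P n"
  shows "lower_uniformly_adjusted N M P 1"
  unfolding lower_uniformly_adjusted_def
proof (intro allI impI, elim conjE)
  fix \<eta> :: real and N2 and x :: "nat \<Rightarrow> 'a"
  assume *: "\<eta> > 0" "N2 \<subseteq> N" "infinite N2" "\<forall>n\<in>N2. x n \<in> M n \<and> norm (x n) = 1"
  have "limsup_on N2 (\<lambda>n. norm (x n - 0 - 0)) \<le> ereal (1 + \<eta>)"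
    unfolding limsup_on_def
    by (rule Limsup_bounded) (use * in \<open>auto simp: eventually_inf_principal\<close>)
  with * assms show "\<exists>N3 y z. N3 \<subseteq> N2 \<and> infinite N3 \<and> (\<forall>n\<in>N3. y n \<in> P n) \<and>
        limsup_on N3 (\<lambda>n. norm (x n - y n - z)) \<le> ereal (1 + \<eta>)"
    by (intro exI[of _ N2] exI[of _ "\<lambda>_. 0"] exI[of _ 0]) auto
qed

lemma uniform_adjustment_le_1:
  assumes "\<And>n. n \<in> N \<Longrightarrow> 0 \<in> P n"
  shows "uniform_adjustment N M P \<le> 1"
  unfolding uniform_adjustment_def
  by (rule cInf_lower) (use lower_uniformly_adjusted_1[of N P M] assms in \<open>auto intro: bdd_belowI\<close>)

lemma ss_adjusted_1:
  assumes "\<And>n. n \<in> N \<Longrightarrow> 0 \<in> P n"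
  shows "ss_adjusted smul N M P 1"
  unfolding ss_adjusted_def
  using uniform_adjustment_le_1[of _ P] assms by (meson order_refl subsetD)


text \<open>
  The norm of the product type \<^typ>\<open>'a \<times> 'b\<close> in the library is the Euclidean one,
  so the product with the maximum norm needs a type of its own.
\<close>

datatype ('a, 'b) maxprod = MPair (mfst: 'a) (msnd: 'b)

instantiation maxprod :: (real_vector, real_vector) real_vector
begin

definition zero_maxprod :: "('a, 'b) maxprod" where
  "0 = MPair 0 0"
definition plus_maxprod :: "('a, 'b) maxprod \<Rightarrow> ('a, 'b) maxprod \<Rightarrow> ('a, 'b) maxprod" where
  "p + q = MPair (mfst p + mfst q) (msnd p + msnd q)"
definition minus_maxprod :: "('a, 'b) maxprod \<Rightarrow> ('a, 'b) maxprod \<Rightarrow> ('a, 'b) maxprod" where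
  "p - q = MPair (mfst p - mfst q) (msnd p - msnd q)"
definition uminus_maxprod :: "('a, 'b) maxprod \<Rightarrow> ('a, 'b) maxprod" where
  "- p = MPair (- mfst p) (- msnd p)"
definition scaleR_maxprod :: "real \<Rightarrow> ('a, 'b) maxprod \<Rightarrow> ('a, 'b) maxprod" where
  "r *\<^sub>R p = MPair (r *\<^sub>R mfst p) (r *\<^sub>R msnd p)"

instance
  by standard
    (simp_all add: plus_maxprod_def zero_maxprod_def uminus_maxprod_def minus_maxprod_def
      scaleR_maxprod_def algebra_simps)

end

instantiation maxprod :: (real_normed_vector, real_normed_vector) real_normed_vector
begin

definition norm_maxprod :: "('a, 'b) maxprod \<Rightarrow> real" where
  "norm p = max (norm (mfst p)) (norm (msnd p))"
definition sgn_maxprod :: "('a, 'b) maxprod \<Rightarrow> ('a, 'b) maxprod" where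
  "sgn (p :: ('a, 'b) maxprod) = inverse (norm p) *\<^sub>R p"
definition dist_maxprod :: "('a, 'b) maxprod \<Rightarrow> ('a, 'b) maxprod \<Rightarrow> real" where
  "dist (p :: ('a, 'b) maxprod) q = norm (p - q)"
definition uniformity_maxprod :: "(('a, 'b) maxprod \<times> ('a, 'b) maxprod) filter" where
  "uniformity = (INF e\<in>{0<..}. principal {(p, q :: ('a, 'b) maxprod). dist p q < e})"
definition open_maxprod :: "('a, 'b) maxprod set \<Rightarrow> bool" where
  "open (U :: ('a, 'b) maxprod set) \<longleftrightarrow>
    (\<forall>p\<in>U. eventually (\<lambda>(p', q). p' = p \<longrightarrow> q \<in> U) uniformity)"

instance
proof
  fix p q :: "('a, 'b) maxprod" and a :: real and U :: "('a, 'b) maxprod set"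
  show "dist p q = norm (p - q)" "sgn p = inverse (norm p) *\<^sub>R p"
    by (simp_all add: dist_maxprod_def sgn_maxprod_def)
  show "uniformity = (INF e\<in>{0<..}. principal {(p, q :: ('a, 'b) maxprod). dist p q < e})"
    by (rule uniformity_maxprod_def)
  show "open U \<longleftrightarrow> (\<forall>p\<in>U. eventually (\<lambda>(p', q). p' = p \<longrightarrow> q \<in> U) uniformity)"
    by (rule open_maxprod_def)
  show "norm p = 0 \<longleftrightarrow> p = 0"
    by (cases p) (auto simp: norm_maxprod_def zero_maxprod_def max_def split: if_splits)
  show "norm (p + q) \<le> norm p + norm q"
    using norm_triangle_ineq[of "mfst p" "mfst q"] norm_triangle_ineq[of "msnd p" "msnd q"]
    by (auto simp: norm_maxprod_def plus_maxprod_def)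
  show "norm (a *\<^sub>R p) = \<bar>a\<bar> * norm p"
    by (auto simp: norm_maxprod_def scaleR_maxprod_def max_mult_distrib_left)
qed

end

lemma dist_maxprod: "dist p q = max (dist (mfst p) (mfst q)) (dist (msnd p) (msnd q))"
  by (simp add: dist_maxprod_def norm_maxprod_def minus_maxprod_def dist_norm)

instance maxprod :: (banach, banach) banach
proof
  fix u :: "nat \<Rightarrow> ('a, 'b) maxprod"
  assume "Cauchy u"
  then have "Cauchy (\<lambda>n. mfst (u n))" "Cauchy (\<lambda>n. msnd (u n))"
    by (simp_all add: Cauchy_def dist_maxprod) meson+
  then obtain a b where a: "(\<lambda>n. mfst (u n)) \<longlonglongrightarrow> a" and b: "(\<lambda>n. msnd (u n)) \<longlonglongrightarrow> b"
    by (auto simp: Cauchy_convergent_iff convergent_def)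
  have "u \<longlonglongrightarrow> MPair a b"
  proof (rule tendstoI)
    fix e :: real assume "e > 0"
    from tendstoD[OF a this] tendstoD[OF b this]
    show "\<forall>\<^sub>F n in sequentially. dist (u n) (MPair a b) < e"
      by eventually_elim (simp add: dist_maxprod)
  qed
  then show "convergent u"
    by (auto simp: convergent_def)
qed

definition maxprod_scale ::
  "('k \<Rightarrow> 'x \<Rightarrow> 'x) \<Rightarrow> ('k \<Rightarrow> 'y \<Rightarrow> 'y) \<Rightarrow> 'k \<Rightarrow> ('x, 'y) maxprod \<Rightarrow> ('x, 'y) maxprod" where
  "maxprod_scale scaleX scaleY c p = MPair (scaleX c (mfst p)) (scaleY c (msnd p))"

lemma normed_scaling_maxprod:
  assumes "normed_scaling scaleX" "normed_scaling scaleY"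
  shows "normed_scaling (maxprod_scale scaleX scaleY)"
proof -
  interpret X: normed_scaling scaleX by fact
  interpret Y: normed_scaling scaleY by fact
  show ?thesis
    by unfold_locales
      (simp_all add: maxprod_scale_def plus_maxprod_def scaleR_maxprod_def norm_maxprod_def
        X.scale_right_distrib Y.scale_right_distrib X.scale_left_distrib Y.scale_left_distrib
        X.norm_smul Y.norm_smul X.smul_of_real Y.smul_of_real max_mult_distrib_left)
qed

definition graph :: "('x \<Rightarrow> 'y) \<Rightarrow> ('x, 'y) maxprod set" where
  "graph A = {MPair x (A x) | x. True}"

definition ss_uniform_adjustment_op ::
  "('k :: field \<Rightarrow> 'x :: real_normed_vector \<Rightarrow> 'x) \<Rightarrow> ('k \<Rightarrow> 'y :: real_normed_vector \<Rightarrow> 'y) \<Rightarrow>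
    nat set \<Rightarrow> (nat \<Rightarrow> 'x \<Rightarrow> 'y) \<Rightarrow> (nat \<Rightarrow> 'x \<Rightarrow> 'y) \<Rightarrow> real" where
  "ss_uniform_adjustment_op scaleX scaleY N A B =
    ss_uniform_adjustment (maxprod_scale scaleX scaleY) N (\<lambda>n. graph (A n)) (\<lambda>n. graph (B n))"

end

theory Submission
  imports Defs
begin

text \<open>
  For \<open>K \<subseteq> graph A\<close> with \<open>A\<close> strictly singular, it suffices to find an infinite-dimensional closed
  \<open>Z' \<subseteq> mfst ` K\<close> on which \<open>norm (A x) \<le> \<epsilon> * norm x\<close>: taking \<open>\<epsilon> = 1 / (n + 1)\<close> for the \<open>n\<close>-th
  operator, a unit vector \<open>(x, A\<^sub>n x)\<close> is at distance at most \<open>1 / (n + 1)\<close> from \<open>(x, 0)\<close>.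
  Such a \<open>Z'\<close> is the closed span of unit vectors \<open>z\<^sub>k\<close> chosen inductively in the common kernel of
  norming functionals \<open>g\<^sub>i\<close> of the earlier \<open>z\<^sub>i\<close>, with \<open>norm (A z\<^sub>k) \<le> \<epsilon> / (2 * 4 ^ k)\<close>.  Applying
  \<open>g\<^sub>0, g\<^sub>1, \<dots>\<close> successively to \<open>x = \<Sum>a\<^sub>i z\<^sub>i\<close> gives \<open>norm a\<^sub>k \<le> 2 ^ k * norm x\<close>, so that
  \<open>norm (A x) \<le> \<Sum>\<epsilon> * norm x / 2 ^ (k + 1) \<le> \<epsilon> * norm x\<close>.
  The functionals are real-linear even over complex scalars, and come from minimal sublinear functionals
  below the norm.
\<close>

section \<open>Norming functionals\<close>

definition sublinear :: "('a :: real_vector \<Rightarrow> real) \<Rightarrow> bool" where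
  "sublinear p \<longleftrightarrow> (\<forall>x y. p (x + y) \<le> p x + p y) \<and> (\<forall>r>0. \<forall>x. p (r *\<^sub>R x) = r * p x)"

text \<open>One inequality gives homogeneity: applied to \<open>inverse r\<close> and
  \<open>r *\<^sub>R x\<close> it yields the reverse one. This suits functionals defined as infima,
  where upper bounds come first.\<close>

lemma sublinearI:
  assumes add: "\<And>x y. p (x + y) \<le> p x + p y"
    and scale: "\<And>r x. r > 0 \<Longrightarrow> p (r *\<^sub>R x) \<le> r * p x"
  shows "sublinear p"
  unfolding sublinear_def
proof (intro conjI allI impI add)
  fix r :: real and x
  assume r: "r > 0"
  have "p (inverse r *\<^sub>R (r *\<^sub>R x)) \<le> inverse r * p (r *\<^sub>R x)"
    using r by (intro scale) simp
  then have "r * p x \<le> p (r *\<^sub>R x)"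
    using r by (simp add: field_simps)
  with scale[OF r, of x] show "p (r *\<^sub>R x) = r * p x" by simp
qed

lemma sublinear_add: "sublinear p \<Longrightarrow> p (x + y) \<le> p x + p y"
  by (simp add: sublinear_def)

lemma sublinear_zero:
  assumes "sublinear p" shows "p 0 = 0"
proof -
  have "p (2 *\<^sub>R 0) = 2 * p 0"
    using assms unfolding sublinear_def by (metis zero_less_numeral)
  then show ?thesis by simp
qed

lemma sublinear_scale: "sublinear p \<Longrightarrow> r \<ge> 0 \<Longrightarrow> p (r *\<^sub>R x) = r * p x"
  by (cases "r = 0") (auto simp: sublinear_zero sublinear_def)

lemma sublinear_minus: "sublinear p \<Longrightarrow> - p (- x) \<le> p x"
  using sublinear_add[of p x "- x"] sublinear_zero[of p] by simp

lemma sublinear_norm: "sublinear (norm :: 'a :: real_normed_vector \<Rightarrow> real)"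
  by (rule sublinearI) (simp_all add: norm_triangle_ineq)

text \<open>For sublinear \<open>p\<close> this is the largest sublinear functional below
  \<open>p\<close> whose value at \<open>- z\<close> is at most \<open>- p z\<close>;
  \<open>t = 0\<close> gives the first bound and \<open>t = 1\<close> the second.\<close>

definition slide :: "('a :: real_vector \<Rightarrow> real) \<Rightarrow> 'a \<Rightarrow> 'a \<Rightarrow> real" where
  "slide p z x = (INF t\<in>{0..}. p (x + t *\<^sub>R z) - t * p z)"

text \<open>The infimum is finite: subadditivity gives \<open>s * p z = p (s *\<^sub>R z) \<le> p (x
  + s *\<^sub>R z) + p (- x)\<close>, so \<open>- p (- x)\<close> is a lower bound.\<close>

lemma slide_le:
  assumes p: "sublinear p" and "t \<ge> 0"
  shows "slide p z x \<le> p (x + t *\<^sub>R z) - t * p z"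
proof -
  have "- p (- x) \<le> p (x + s *\<^sub>R z) - s * p z" if "s \<ge> 0" for s
    using sublinear_add[OF p, of "x + s *\<^sub>R z" "- x"] sublinear_scale[OF p that, of z] by simp
  then show ?thesis
    unfolding slide_def using assms(2) by (intro cINF_lower bdd_belowI2[of _ "- p (- x)"]) auto
qed

lemma slide_greatest:
  "(\<And>t. t \<ge> 0 \<Longrightarrow> b \<le> p (x + t *\<^sub>R z) - t * p z) \<Longrightarrow> b \<le> slide p z x"
  unfolding slide_def by (rule cINF_greatest) auto

text \<open>Parameters \<open>s\<close> for \<open>x\<close> and \<open>t\<close> for
  \<open>y\<close> combine to \<open>s + t\<close> for \<open>x + y\<close>; the infimum is then
  taken over \<open>t\<close> and over \<open>s\<close> in turn. For homogeneity, \<open>t\<close>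
  is rescaled to \<open>r * t\<close>.\<close>

lemma sublinear_slide:
  assumes p: "sublinear p"
  shows "sublinear (slide p z)"
proof (rule sublinearI)
  fix x y
  have *: "slide p z (x + y) \<le> (p (x + s *\<^sub>R z) - s * p z) + (p (y + t *\<^sub>R z) - t * p z)"
    if "s \<ge> 0" "t \<ge> 0" for s t
    using slide_le[OF p, of "s + t" z "x + y"] sublinear_add[OF p, of "x + s *\<^sub>R z" "y + t *\<^sub>R z"] that
    by (simp add: algebra_simps)
  have "slide p z (x + y) - (p (x + s *\<^sub>R z) - s * p z) \<le> slide p z y" if "s \<ge> 0" for s
  proof (rule slide_greatest)
    fix t :: real
    assume "t \<ge> 0"
    from *[OF that this]
    show "slide p z (x + y) - (p (x + s *\<^sub>R z) - s * p z) \<le> p (y + t *\<^sub>R z) - t * p z"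
      by simp
  qed
  then have "slide p z (x + y) - slide p z y \<le> slide p z x"
    by (intro slide_greatest) (simp add: algebra_simps)
  then show "slide p z (x + y) \<le> slide p z x + slide p z y" by simp
next
  fix r :: real and x
  assume r: "r > 0"
  have "slide p z (r *\<^sub>R x) / r \<le> p (x + t *\<^sub>R z) - t * p z" if "t \<ge> 0" for t
    using slide_le[OF p, of "r * t" z "r *\<^sub>R x"] sublinear_scale[OF p, of r "x + t *\<^sub>R z"] r that
    by (simp add: field_simps scaleR_add_right)
  then have "slide p z (r *\<^sub>R x) / r \<le> slide p z x"
    by (rule slide_greatest)
  then show "slide p z (r *\<^sub>R x) \<le> r * slide p z x"
    using r by (simp add: field_simps)
qed

text \<open>Zorn's lemma for the reversed pointwise order. A nonempty chain is bounded by its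
  pointwise infimum, which is finite because \<open>- p (- x) \<le> - q (- x) \<le> q x\<close> for
  every member \<open>q\<close>.\<close>

lemma minimal_sublinear_exists:
  assumes p: "sublinear p"
  obtains g where "sublinear g" "g \<le> p" "\<And>h. sublinear h \<Longrightarrow> h \<le> g \<Longrightarrow> h = g"
proof -
  define S where "S = {q. sublinear q \<and> q \<le> p}"
  have "\<exists>g\<in>S. \<forall>h\<in>S. h \<le> g \<longrightarrow> h = g"
  proof (rule predicate_Zorn[of S "\<lambda>q h. h \<le> q"])
    show "partial_order_on S (relation_of (\<lambda>q h. h \<le> q) S)"
      by (rule partial_order_on_relation_ofI) auto
  next
    fix C assume C: "C \<in> Chains (relation_of (\<lambda>q h. h \<le> q) S)"
    show "\<exists>u\<in>S. \<forall>q\<in>C. u \<le> q"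
    proof (cases "C = {}")
      case True
      with p show ?thesis by (auto simp: S_def)
    next
      case False
      have CS: "sublinear q" "q \<le> p" if "q \<in> C" for q
        using C that by (auto simp: Chains_def relation_of_def S_def)
      have total: "q \<le> h \<or> h \<le> q" if "q \<in> C" "h \<in> C" for q h
        using C that by (auto simp: Chains_def relation_of_def)
      define u where "u x = (INF q\<in>C. q x)" for x
      have u_le: "u x \<le> q x" if "q \<in> C" for q x
        unfolding u_def
      proof (intro cINF_lower bdd_belowI2[of _ "- p (- x)"] that)
        fix h assume "h \<in> C"
        then show "- p (- x) \<le> h x"
          using sublinear_minus[OF CS(1), of h x] le_funD[OF CS(2), of h "- x"] by simp
      qed
      have u_greatest: "b \<le> u x" if "\<And>q. q \<in> C \<Longrightarrow> b \<le> q x" for b x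
        unfolding u_def using that False by (intro cINF_greatest)
      have "sublinear u"
      proof (rule sublinearI)
        fix x y
        \<comment> \<open>The chain is totally ordered, so the smaller of \<open>q\<close> and
          \<open>h\<close> can be used at both points.\<close>
        have *: "u (x + y) \<le> q x + h y" if "q \<in> C" "h \<in> C" for q h
          using total[OF that]
        proof
          assume "q \<le> h"
          then show ?thesis
            using u_le[OF that(1), of "x + y"] sublinear_add[OF CS(1)[OF that(1)], of x y]
              le_funD[of q h y] by simp
        next
          assume "h \<le> q"
          then show ?thesis
            using u_le[OF that(2), of "x + y"] sublinear_add[OF CS(1)[OF that(2)], of x y]
              le_funD[of h q x] by simp
        qed
        have "u (x + y) - q x \<le> u y" if "q \<in> C" for q
          using *[OF that] by (intro u_greatest) (simp add: algebra_simps)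
        then have "u (x + y) - u y \<le> u x"
          by (intro u_greatest) (simp add: algebra_simps)
        then show "u (x + y) \<le> u x + u y" by simp
      next
        fix r :: real and x
        assume r: "r > 0"
        have "u (r *\<^sub>R x) / r \<le> q x" if "q \<in> C" for q
          using u_le[OF that, of "r *\<^sub>R x"] sublinear_scale[OF CS(1)[OF that], of r x] r
          by (simp add: field_simps)
        then have "u (r *\<^sub>R x) / r \<le> u x" by (rule u_greatest)
        then show "u (r *\<^sub>R x) \<le> r * u x" using r by (simp add: field_simps)
      qed
      moreover have "u \<le> q" if "q \<in> C" for q
        using u_le[OF that] by (simp add: le_fun_def)
      moreover from this have "u \<le> p"
        using False CS(2) by (meson ex_in_conv order_trans)
      ultimately show ?thesis by (auto simp: S_def)
    qed
  qed
  \<comment> \<open>A sublinear \<open>h \<le> g\<close> also lies below \<open>p\<close>, so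
    minimality within \<open>S\<close> is minimality among all sublinear functionals.\<close>
  then show ?thesis
    using that order_trans unfolding S_def by blast
qed

text \<open>
  If \<open>g\<close> is minimal then \<open>slide g z = g\<close>, which reads \<open>g x + g z \<le> g (x + z)\<close>.
\<close>

lemma minimal_sublinear_linear:
  assumes g: "sublinear g" and min: "\<And>h. sublinear h \<Longrightarrow> h \<le> g \<Longrightarrow> h = g"
  shows "linear g"
proof -
  have "slide g z = g" for z
    using slide_le[OF g, of 0 z] by (intro min sublinear_slide g) (simp add: le_fun_def)
  then have add: "g (x + z) = g x + g z" for x z
    using slide_le[OF g, of 1 z x] sublinear_add[OF g, of x z] by simp
  have neg: "g (- x) = - g x" for x
    using add[of x "- x"] sublinear_zero[OF g] by simp
  show ?thesis
  proof (rule linearI)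
    fix r :: real and x
    show "g (r *\<^sub>R x) = r *\<^sub>R g x"
      using sublinear_scale[OF g, of r x] sublinear_scale[OF g, of "- r" x] neg[of "r *\<^sub>R x"]
      by (cases "r \<ge> 0") simp_all
  qed (rule add)
qed

text \<open>Starting below \<open>slide norm z\<close> instead of \<open>norm\<close> forces
  \<open>g (- z) \<le> - norm z\<close>. A minimal \<open>g\<close> is linear, so this reads
  \<open>norm z \<le> g z\<close>, while \<open>g \<le> norm\<close> gives the converse.\<close>

lemma norming_functional_exists:
  fixes z :: "'a :: real_normed_vector"
  obtains g where "linear g" "\<And>x. \<bar>g x\<bar> \<le> norm x" "g z = norm z"
proof -
  obtain g where g: "sublinear g" "g \<le> slide norm z"
      and min: "\<And>h. sublinear h \<Longrightarrow> h \<le> g \<Longrightarrow> h = g"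
    using minimal_sublinear_exists[OF sublinear_slide[OF sublinear_norm]] by metis
  interpret linear g
    using minimal_sublinear_linear[OF g(1) min] .
  have le: "g x \<le> norm x" for x
    using le_funD[OF g(2), of x] slide_le[OF sublinear_norm order_refl, of z x] by simp
  have "g (- z) \<le> - norm z"
    using le_funD[OF g(2), of "- z"] slide_le[OF sublinear_norm zero_le_one, of z "- z"] by simp
  then have "g z = norm z"
    using le[of z] by (simp add: neg)
  moreover have "\<bar>g x\<bar> \<le> norm x" for x
    using le[of x] le[of "- x"] by (simp add: neg abs_le_iff)
  ultimately show ?thesis
    using that linear_axioms by blast
qed

section \<open>Common kernels of finitely many functionals\<close>

text \<open>Sums over initial segments are the form in which the coefficients get bounded later. To
  add a term at index \<open>j\<close>, the sum is padded with zeros up to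
  \<open>max n (Suc j)\<close> and \<open>c\<close> is added to the \<open>j\<close>-th
  coefficient.\<close>

lemma (in vector_space) span_range_nat:
  fixes z :: "nat \<Rightarrow> 'b"
  assumes "x \<in> span (range z)"
  shows "\<exists>a n. x = (\<Sum>i<n. scale (a i) (z i))"
  using assms
proof (induction rule: span_induct_alt)
  case base
  show ?case by (rule exI, rule exI[of _ 0]) simp
next
  case (step c x y)
  then obtain j a n where x: "x = z j" and y: "y = (\<Sum>i<n. scale (a i) (z i))"
    by auto
  define m where "m = max n (Suc j)"
  have "y = (\<Sum>i<m. if i < n then scale (a i) (z i) else 0)"
    unfolding y by (rule sum.mono_neutral_cong_left) (auto simp: m_def)
  moreover have "scale c x = (\<Sum>i<m. if i = j then scale c (z i) else 0)"
    by (auto simp: x m_def less_max_iff_disj)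
  ultimately have "scale c x + y =
      (\<Sum>i<m. (if i = j then scale c (z i) else 0) + (if i < n then scale (a i) (z i) else 0))"
    by (simp only: sum.distrib)
  also have "\<dots> = (\<Sum>i<m. scale ((if i = j then c else 0) + (if i < n then a i else 0)) (z i))"
    by (intro sum.cong) (auto simp: scale_left_distrib)
  finally show ?case by (intro exI)
qed

lemma infinite_dimensional_mono:
  "infinite_dimensional smul S \<Longrightarrow> S \<subseteq> T \<Longrightarrow> infinite_dimensional smul T"
  unfolding infinite_dimensional_def by (meson order_trans)

context normed_scaling
begin

lemma smul_scaleR: "smul (r *\<^sub>R c) x = r *\<^sub>R smul c x"
  by (simp add: scaleR_conv_of_real flip: scale_scale smul_of_real)

lemma scaleR_smul: "smul c (r *\<^sub>R x) = r *\<^sub>R smul c x"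
  by (simp add: mult.commute flip: smul_of_real)

lemma bounded_linear_smul: "bounded_linear (smul c)"
  by (rule bounded_linear_intro[of _ "norm c"])
    (simp_all add: scale_right_distrib scaleR_smul norm_smul mult.commute)

lemma subspace_scaleR: "subspace S \<Longrightarrow> x \<in> S \<Longrightarrow> r *\<^sub>R x \<in> S"
  by (metis smul_of_real subspace_scale)

lemma closed_subspace_closure:
  assumes "subspace S"
  shows "closed_subspace smul (closure S)"
  unfolding closed_subspace_def subspace_def
proof (intro conjI ballI allI)
  show "0 \<in> closure S"
    using assms closure_subset subspace_0 by blast
next
  fix x y assume "x \<in> closure S" "y \<in> closure S"
  then obtain u v where "\<And>n. u n \<in> S" "u \<longlonglongrightarrow> x" "\<And>n. v n \<in> S" "v \<longlonglongrightarrow> y"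
    by (auto simp: closure_sequential)
  then show "x + y \<in> closure S"
    unfolding closure_sequential
    by (intro exI[of _ "\<lambda>n. u n + v n"]) (auto intro: tendsto_intros subspace_add assms)
next
  fix c x assume "x \<in> closure S"
  then obtain u where "\<And>n. u n \<in> S" "u \<longlonglongrightarrow> x"
    by (auto simp: closure_sequential)
  then show "smul c x \<in> closure S"
    unfolding closure_sequential
    by (intro exI[of _ "\<lambda>n. smul c (u n)"])
      (auto intro: bounded_linear.tendsto[OF bounded_linear_smul] subspace_scale assms)
qed simp

text \<open>Each functional lowers the dimension by at most one: if \<open>h u \<noteq> 0\<close>,
  then subtracting \<open>(h x / h u) *\<^sub>R u\<close> moves \<open>x\<close> into the kernel of
  \<open>h\<close>. \<open>V\<close> is only a real subspace, since kernels of real-linear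
  functionals need not be stable under complex scalars.\<close>

lemma finite_span_functional_kernels:
  assumes "finite F" and "\<And>h. h \<in> F \<Longrightarrow> linear h"
    and "real_vector.subspace V" and "finite B" and "{x \<in> V. \<forall>h\<in>F. h x = (0 :: real)} \<subseteq> span B"
  shows "\<exists>B. finite B \<and> V \<subseteq> span B"
  using assms
proof (induction F arbitrary: V B)
  case empty
  then show ?case by auto
next
  case (insert h F)
  interpret h: linear h using insert.prems by simp
  let ?V = "V \<inter> {x. h x = 0}"
  have "real_vector.subspace ?V"
    using insert.prems(2) by (auto simp: real_vector.subspace_def h.add h.scale)
  moreover have "{x \<in> ?V. \<forall>h\<in>F. h x = 0} \<subseteq> span B"
    using insert.prems(4) by auto
  ultimately obtain B' where B': "finite B'" "?V \<subseteq> span B'"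
    using insert.IH[of ?V B] insert.prems by auto
  show ?case
  proof (cases "V \<subseteq> {x. h x = 0}")
    case True
    with B' show ?thesis by auto
  next
    case False
    then obtain u where u: "u \<in> V" "h u \<noteq> 0" by auto
    have "x \<in> span (insert u B')" if "x \<in> V" for x
    proof -
      have "x - (h x / h u) *\<^sub>R u \<in> ?V"
        using that u insert.prems(2)
        by (auto simp: h.diff h.scale real_vector.subspace_diff real_vector.subspace_scale)
      then have "x - smul (of_real (h x / h u)) u \<in> span B'"
        unfolding smul_of_real using B' by blast
      then show ?thesis by (auto simp: span_insert)
    qed
    with B'(1) show ?thesis by (intro exI[of _ "insert u B'"]) auto
  qed
qed

text \<open>
  The functionals are only real-linear; quantifying over all scalars \<open>c\<close> makes \<open>W\<close> a subspace over
  the scalar field, and by linearity the \<open>c\<close> in a real basis already determine it.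
\<close>

lemma closed_infinite_dimensional_kernels:
  assumes Z: "closed_subspace smul Z" "infinite_dimensional smul Z"
    and F: "finite F" "\<And>h. h \<in> F \<Longrightarrow> bounded_linear (h :: 'e \<Rightarrow> real)"
  defines "W \<equiv> {x \<in> Z. \<forall>h\<in>F. \<forall>c. h (smul c x) = 0}"
  shows "closed_subspace smul W" "infinite_dimensional smul W"
proof -
  have Zs: "subspace Z" "closed Z" using Z(1) by (auto simp: closed_subspace_def)
  have bl: "bounded_linear (\<lambda>x. h (smul c x))" if "h \<in> F" for h c
    using bounded_linear_compose[OF F(2)[OF that] bounded_linear_smul] .
  have "closed {x. h (smul c x) = 0}" if "h \<in> F" for h c
    using bl[OF that]
    by (intro closed_Collect_eq linear_continuous_on continuous_intros)
  then have "closed (Z \<inter> (\<Inter>h\<in>F. \<Inter>c. {x. h (smul c x) = 0}))"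
    by (intro closed_Int closed_INT Zs) auto
  also have "Z \<inter> (\<Inter>h\<in>F. \<Inter>c. {x. h (smul c x) = 0}) = W"
    by (auto simp: W_def)
  finally have "closed W" .
  moreover have "subspace W"
    unfolding subspace_def W_def using Zs(1)
    by (auto simp: subspace_0 subspace_add subspace_scale scale_right_distrib
        bounded_linear.linear[OF F(2), THEN linear_add] bounded_linear.linear[OF F(2), THEN linear_0])
  ultimately show "closed_subspace smul W"
    by (simp add: closed_subspace_def)
  show "infinite_dimensional smul W"
    unfolding infinite_dimensional_def
  proof
    assume "\<exists>B. finite B \<and> W \<subseteq> span B"
    then obtain B where B: "finite B" "W \<subseteq> span B" by auto
    let ?F = "(\<lambda>(h, b) x. h (smul b x)) ` (F \<times> (Basis :: 'k set))"
    have "h (smul c x) = 0" if h: "h \<in> F" and z: "\<forall>b\<in>Basis. h (smul b x) = 0" for h c x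
    proof -
      interpret h: bounded_linear h by (rule F(2)[OF h])
      have "h (smul c x) = h (smul (\<Sum>b\<in>Basis. (c \<bullet> b) *\<^sub>R b) x)"
        by (simp add: euclidean_representation)
      also have "\<dots> = (\<Sum>b\<in>Basis. (c \<bullet> b) * h (smul b x))"
        by (simp add: scale_sum_left smul_scaleR h.sum h.scaleR)
      finally show ?thesis using z by simp
    qed
    then have "{x \<in> Z. \<forall>h\<in>?F. h x = 0} \<subseteq> W"
      by (auto simp: W_def)
    with B have "{x \<in> Z. \<forall>h\<in>?F. h x = 0} \<subseteq> span B" by auto
    moreover have "linear h" if "h \<in> ?F" for h
      using that bl by (auto intro: bounded_linear.linear)
    moreover have "real_vector.subspace Z"
      using Zs(1) by (simp add: real_vector.subspace_def subspace_0 subspace_add subspace_scaleR)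
    ultimately have "\<exists>B. finite B \<and> Z \<subseteq> span B"
      using finite_span_functional_kernels[of ?F Z B] F(1) B(1) by auto
    with Z(2) show False by (simp add: infinite_dimensional_def)
  qed
qed

end

section \<open>Subspaces on which a strictly singular operator is small\<close>

context normed_scaling
begin

text \<open>Under \<open>g k\<close> the terms after the \<open>k\<close>-th vanish by
  \<open>orth\<close>, and the earlier ones are controlled by strong induction.\<close>

lemma triangular_coefficient_bound:
  assumes z: "\<And>i. norm (z i) = 1"
    and g: "\<And>i. linear (g i)" "\<And>i x. \<bar>g i x\<bar> \<le> norm x" "\<And>i. g i (z i) = (1 :: real)"
    and orth: "\<And>i k c. i < k \<Longrightarrow> g i (smul c (z k)) = 0"
    and "k < n"
  shows "norm (a k) \<le> 2 ^ k * norm (\<Sum>i<n. smul (a i) (z i))"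
  using \<open>k < n\<close>
proof (induction k rule: less_induct)
  case (less k)
  let ?x = "\<Sum>i<n. smul (a i) (z i)"
  show ?case
  proof (cases "a k = 0")
    case False
    \<comment> \<open>\<open>g k\<close> is only real-linear, so a complex \<open>a k\<close> cannot
      be pulled out of it. Multiplying by the inverse beforehand turns the \<open>k\<close>-th term
      into \<open>z k\<close>, where \<open>g k\<close> is 1.\<close>
    define c where "c = inverse (a k)"
    interpret g: linear "g k" by (rule g(1))
    have "g k (smul c ?x) = (\<Sum>i<n. g k (smul (c * a i) (z i)))"
      by (simp add: scale_sum_right g.sum)
    also have "\<dots> = (\<Sum>i<Suc k. g k (smul (c * a i) (z i)))"
      using less.prems orth by (intro sum.mono_neutral_right) auto
    also have "\<dots> = (\<Sum>i<k. g k (smul (c * a i) (z i))) + 1"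
      using False by (simp add: c_def g(3))
    finally have "1 \<le> \<bar>g k (smul c ?x)\<bar> + \<bar>\<Sum>i<k. g k (smul (c * a i) (z i))\<bar>"
      by linarith
    also have "\<dots> \<le> norm (smul c ?x) + (\<Sum>i<k. norm (smul (c * a i) (z i)))"
      by (intro add_mono g(2) order_trans[OF sum_abs] sum_mono)
    also have "\<dots> = norm c * (norm ?x + (\<Sum>i<k. norm (a i)))"
      by (simp add: norm_smul z norm_mult sum_distrib_left algebra_simps)
    also have "\<dots> \<le> norm c * (norm ?x + (\<Sum>i<k. 2 ^ i * norm ?x))"
      using less.IH less.prems by (intro mult_left_mono add_left_mono sum_mono) auto
    \<comment> \<open>The geometric sum is \<open>2 ^ k - 1\<close>; this is where the constants
      \<open>2 ^ k\<close> come from.\<close>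
    also have "norm ?x + (\<Sum>i<k. 2 ^ i * norm ?x) = 2 ^ k * norm ?x"
      by (simp add: sum_distrib_right[symmetric] sum_gp_strict algebra_simps)
    finally show ?thesis
      using False by (simp add: c_def norm_divide field_simps)
  qed simp
qed

text \<open>By the bound, a vanishing combination has vanishing coefficients. Injectivity comes
  first, so that sums over subsets of \<open>range z\<close> can be reindexed by natural
  numbers.\<close>

lemma coefficient_bound_independent:
  assumes bound: "\<And>a k n. k < n \<Longrightarrow> norm (a k) \<le> 2 ^ k * norm (\<Sum>i<n. smul (a i) (z i))"
  shows "inj z" "independent (range z)"
proof -
  show inj: "inj z"
  proof (rule linorder_injI)
    fix i k :: nat assume "i < k"
    show "z i \<noteq> z k"
    proof
      assume eq: "z i = z k"
      \<comment> \<open>These coefficients represent \<open>z i - z k = 0\<close>, yet the one at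
        \<open>i\<close> is 1.\<close>
      let ?a = "\<lambda>j. if j = i then 1 else if j = k then - 1 else 0"
      have "(\<Sum>j<Suc k. smul (?a j) (z j)) = (\<Sum>j<Suc k. (if j = i then z i else 0) + (if j = k then - z k else 0))"
        using \<open>i < k\<close> by (intro sum.cong) auto
      also have "\<dots> = 0"
        using \<open>i < k\<close> eq by (simp add: sum.distrib del: sum.lessThan_Suc)
      finally show False
        using bound[of i "Suc k" ?a] \<open>i < k\<close> by simp
    qed
  qed
  show "independent (range z)"
    unfolding independent_explicit_finite_subsets
  proof (intro allI impI ballI)
    fix S u v
    assume S: "S \<subseteq> range z" "finite S" "(\<Sum>v\<in>S. smul (u v) v) = 0" and v: "v \<in> S"
    obtain I where I: "S = z ` I" "finite I"
      using S(1,2) by (meson finite_subset_image)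
    obtain n where n: "I \<subseteq> {..<n}"
      using I(2) finite_nat_bounded by blast
    let ?a = "\<lambda>i. if i \<in> I then u (z i) else 0"
    have "(\<Sum>i<n. smul (?a i) (z i)) = (\<Sum>i\<in>I. smul (u (z i)) (z i))"
      using n by (intro sum.mono_neutral_cong_right) auto
    also have "\<dots> = 0"
      using S(3) inj by (simp add: I sum.reindex inj_on_subset)
    finally have *: "?a i = 0" if "i < n" for i
      using bound[of i n ?a] that by simp
    obtain i where "v = z i" "i \<in> I" using v by (auto simp: I)
    then show "u v = 0" using *[of i] n by auto
  qed
qed

end

lemma bounded_operator_imp_bounded_linear:
  assumes "normed_scaling scaleX" "normed_scaling scaleY" and A: "bounded_operator scaleX scaleY A"
  shows "bounded_linear A"
proof -
  interpret X: normed_scaling scaleX by fact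
  interpret Y: normed_scaling scaleY by fact
  interpret A: Vector_Spaces.linear scaleX scaleY A
    using A by (simp add: bounded_operator_def)
  obtain C where C: "norm (A x) \<le> C * norm x" for x
    using A by (auto simp: bounded_operator_def)
  show ?thesis
  proof (rule bounded_linear_intro)
    show "A (r *\<^sub>R x) = r *\<^sub>R A x" for r x
      by (metis A.scale X.smul_of_real Y.smul_of_real)
    show "norm (A x) \<le> norm x * C" for x
      using C[of x] by (simp add: mult.commute)
  qed (rule A.add)
qed

lemma strictly_singular_small_subspace:
  fixes scaleX :: "'k :: {real_normed_field, euclidean_space} \<Rightarrow> 'x :: real_normed_vector \<Rightarrow> 'x"
    and scaleY :: "'k \<Rightarrow> 'y :: real_normed_vector \<Rightarrow> 'y"
  assumes "normed_scaling scaleX" "normed_scaling scaleY"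
    and A: "strictly_singular scaleX scaleY A"
    and Z: "closed_subspace scaleX Z" "infinite_dimensional scaleX Z"
    and \<epsilon>: "\<epsilon> > 0"
  obtains L where "closed_subspace scaleX L" "infinite_dimensional scaleX L" "L \<subseteq> Z"
    "\<And>x. x \<in> L \<Longrightarrow> norm (A x) \<le> \<epsilon> * norm x"
proof -
  interpret X: normed_scaling scaleX by fact
  interpret Y: normed_scaling scaleY by fact
  have lin: "Vector_Spaces.linear scaleX scaleY A"
    using A by (simp add: strictly_singular_def bounded_operator_def)
  interpret A: Vector_Spaces.linear scaleX scaleY A by (rule lin)
  have A_smul: "norm (A (scaleX c x)) = norm c * norm (A x)" for c x
    by (simp add: A.scale Y.norm_smul)
  have bl: "bounded_linear A"
    using A assms(1,2) by (simp add: strictly_singular_def bounded_operator_imp_bounded_linear)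
  obtain G :: "'x \<Rightarrow> 'x \<Rightarrow> real"
    where G: "\<And>z. linear (G z)" "\<And>z x. \<bar>G z x\<bar> \<le> norm x" "\<And>z. G z z = norm z"
    using norming_functional_exists by metis
  have blG: "bounded_linear (G z)" for z
    using G(1,2)[of z] by (intro linear_conv_bounded_linear[THEN iffD1] bounded_linear_intro[of _ 1])
      (simp_all add: linear_add linear_scale)
  \<comment> \<open>\<open>P\<close> sees \<open>f\<close> only below \<open>k\<close>, as the
    choice principle demands. The factor \<open>4 ^ k\<close> outweighs the coefficient bound
    \<open>2 ^ k\<close>, and the extra 2 normalises the resulting geometric series.\<close>
  define P where "P f k r \<longleftrightarrow> r \<in> Z \<and> norm r = 1 \<and> (\<forall>i<k. \<forall>c. G (f i) (scaleX c r) = 0) \<and>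
      norm (A r) \<le> \<epsilon> / (2 * 4 ^ k)" for f and k :: nat and r
  have "\<exists>z. \<forall>k. P z k (z k)"
  proof (rule dependent_wellorder_choice)
    fix k :: nat and f
    let ?W = "{x \<in> Z. \<forall>h\<in>(\<lambda>i. G (f i)) ` {..<k}. \<forall>c. h (scaleX c x) = 0}"
    have "closed_subspace scaleX ?W" "infinite_dimensional scaleX ?W"
      using X.closed_infinite_dimensional_kernels[OF Z, of "(\<lambda>i. G (f i)) ` {..<k}"] blG by auto
    moreover have "\<epsilon> / (2 * 4 ^ k) > 0" using \<epsilon> by simp
    ultimately obtain w where w: "w \<in> ?W" "norm (A w) < \<epsilon> / (2 * 4 ^ k) * norm w"
      using A unfolding strictly_singular_def by blast
    \<comment> \<open>The strict inequality fails at 0, so \<open>w\<close> can be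
      normalised.\<close>
    then have "w \<noteq> 0" by auto
    let ?c = "of_real (inverse (norm w))"
    have "scaleX ?c w \<in> Z"
      using w(1) Z(1) by (auto simp: closed_subspace_def intro: X.subspace_scale)
    moreover have "norm (A (scaleX ?c w)) = norm (A w) / norm w"
      unfolding A_smul norm_of_real by (simp add: divide_inverse mult.commute)
    then have "norm (A (scaleX ?c w)) \<le> \<epsilon> / (2 * 4 ^ k)"
      using w(2) \<open>w \<noteq> 0\<close> by (simp add: pos_divide_le_eq)
    ultimately have "P f k (scaleX ?c w)"
      using w(1) \<open>w \<noteq> 0\<close> by (auto simp: P_def X.norm_smul norm_inverse)
    then show "\<exists>r. P f k r" by blast
  qed (simp add: P_def)
  then obtain z where "\<And>k. P z k (z k)" by blast
  then have z: "\<And>k. z k \<in> Z" "\<And>k. norm (z k) = 1" "\<And>i k c. i < k \<Longrightarrow> G (z i) (scaleX c (z k)) = 0"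
    "\<And>k. norm (A (z k)) \<le> \<epsilon> / (2 * 4 ^ k)"
    by (simp_all add: P_def)
  have bound: "norm (a k) \<le> 2 ^ k * norm (\<Sum>i<n. scaleX (a i) (z i))" if "k < n" for a k n
    by (rule X.triangular_coefficient_bound[where g = "\<lambda>i. G (z i)"]) (simp_all add: z G that)
  have small: "norm (A x) \<le> \<epsilon> * norm x" if x_span: "x \<in> X.span (range z)" for x
  proof -
    obtain a n where x: "x = (\<Sum>i<n. scaleX (a i) (z i))"
      using X.span_range_nat[OF x_span] by blast
    have "norm (A x) \<le> (\<Sum>i<n. norm (a i) * norm (A (z i)))"
      unfolding x A.sum A_smul[symmetric] by (rule norm_sum)
    also have "\<dots> \<le> (\<Sum>i<n. (2 ^ i * norm x) * (\<epsilon> / (2 * 4 ^ i)))"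
      using bound[of _ n a] z(4) by (intro sum_mono mult_mono) (auto simp: x)
    also have "\<dots> = (\<Sum>i<n. \<epsilon> * norm x * ((2 / 4) ^ i / 2))"
      by (simp only: power_divide) (simp add: algebra_simps)
    also have "\<dots> = \<epsilon> * norm x * ((\<Sum>i<n. (1 / 2) ^ i) / 2)"
      by (simp add: sum_distrib_left sum_divide_distrib)
    \<comment> \<open>Partial sums of the geometric series with ratio 1/2 stay below 2.\<close>
    also have "\<dots> \<le> \<epsilon> * norm x * 1"
      using \<epsilon> by (intro mult_left_mono) (simp_all add: sum_gp_strict)
    finally show ?thesis by simp
  qed
  define L where "L = closure (X.span (range z))"
  have "closed_subspace scaleX L"
    unfolding L_def by (rule X.closed_subspace_closure) simp
  \<comment> \<open>\<open>range z\<close> is infinite and independent by the coefficient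
    bound.\<close>
  moreover have "infinite_dimensional scaleX L"
    unfolding infinite_dimensional_def
  proof
    assume "\<exists>B. finite B \<and> L \<subseteq> X.span B"
    then obtain B where "finite B" "range z \<subseteq> X.span B"
      unfolding L_def by (meson X.span_superset closure_subset order_trans)
    then have "finite (range z)"
      using X.independent_span_bound X.coefficient_bound_independent(2)[OF bound] by blast
    then show False
      using X.coefficient_bound_independent(1)[OF bound] finite_imageD infinite_UNIV_nat by blast
  qed
  moreover have "L \<subseteq> Z"
    unfolding L_def using Z(1) z(1)
    by (intro closure_minimal X.span_minimal) (auto simp: closed_subspace_def)
  moreover have "norm (A x) \<le> \<epsilon> * norm x" if "x \<in> L" for x
  proof -
    have "closed {x. norm (A x) \<le> \<epsilon> * norm x}"
      by (intro closed_Collect_le continuous_intros linear_continuous_on bl)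
    then have "L \<subseteq> {x. norm (A x) \<le> \<epsilon> * norm x}"
      unfolding L_def using small by (intro closure_minimal) auto
    with that show ?thesis by auto
  qed
  ultimately show ?thesis using that by blast
qed

section \<open>Graphs in the product with the maximum norm\<close>

lemma continuous_on_mfst [continuous_intros]:
  "continuous_on S (mfst :: ('a :: real_normed_vector, 'b :: real_normed_vector) maxprod \<Rightarrow> 'a)"
  unfolding continuous_on_iff dist_maxprod by auto

lemma bounded_linear_graph_map:
  assumes "bounded_linear A"
  shows "bounded_linear (\<lambda>x. MPair x (A x))"
proof -
  interpret A: bounded_linear A by fact
  obtain C where "norm (A x) \<le> norm x * C" for x using A.bounded by blast
  then have "norm (A x) \<le> norm x * max 1 C" for x
    by (meson max.cobounded2 mult_left_mono norm_ge_zero order_trans)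
  moreover have "norm x \<le> norm x * max 1 C" for x :: 'a
    by (simp add: mult_le_cancel_left1)
  ultimately show ?thesis
    by (intro bounded_linear_intro[of _ "max 1 C"])
      (simp_all add: plus_maxprod_def scaleR_maxprod_def norm_maxprod_def A.add A.scaleR)
qed

lemma linear_mfst:
  assumes "normed_scaling scaleX" "normed_scaling scaleY"
  shows "Vector_Spaces.linear (maxprod_scale scaleX scaleY) scaleX mfst"
proof -
  interpret X: normed_scaling scaleX by fact
  interpret XY: normed_scaling "maxprod_scale scaleX scaleY"
    by (rule normed_scaling_maxprod) fact+
  show ?thesis
    by unfold_locales (simp_all add: plus_maxprod_def maxprod_scale_def)
qed

lemma linear_graph_map:
  assumes "normed_scaling scaleX" "normed_scaling scaleY" "Vector_Spaces.linear scaleX scaleY A"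
  shows "Vector_Spaces.linear scaleX (maxprod_scale scaleX scaleY) (\<lambda>x. MPair x (A x))"
proof -
  interpret X: normed_scaling scaleX by fact
  interpret XY: normed_scaling "maxprod_scale scaleX scaleY"
    by (rule normed_scaling_maxprod) fact+
  interpret A: Vector_Spaces.linear scaleX scaleY A by fact
  show ?thesis
    by unfold_locales (simp_all add: plus_maxprod_def maxprod_scale_def A.add A.scale)
qed

text \<open>A linear map carries a finite spanning set to one of the image. Applied to
  \<open>mfst\<close> and to the graph map, this transfers infinite dimension both ways between
  subspaces of a graph and their projections.\<close>

lemma infinite_dimensional_image:
  assumes "Vector_Spaces.linear scaleE scaleF f" and "infinite_dimensional scaleF (f ` S)"
  shows "infinite_dimensional scaleE S"
proof -
  interpret f: Vector_Spaces.linear scaleE scaleF f by fact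
  show ?thesis
    unfolding infinite_dimensional_def
  proof
    assume "\<exists>B. finite B \<and> S \<subseteq> f.vs1.span B"
    then obtain B where "finite B" "S \<subseteq> f.vs1.span B" by auto
    then have "finite (f ` B)" "f ` S \<subseteq> f.vs2.span (f ` B)"
      using f.span_image[of B] by auto
    with assms(2) show False
      unfolding infinite_dimensional_def by blast
  qed
qed

lemma strictly_singular_graph_small_subspace:
  fixes scaleX :: "'k :: {real_normed_field, euclidean_space} \<Rightarrow> 'x :: real_normed_vector \<Rightarrow> 'x"
    and scaleY :: "'k \<Rightarrow> 'y :: real_normed_vector \<Rightarrow> 'y"
  assumes X: "normed_scaling scaleX" and Y: "normed_scaling scaleY"
    and A: "strictly_singular scaleX scaleY A"
    and K: "closed_subspace (maxprod_scale scaleX scaleY) K" "K \<subseteq> graph A"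
      "infinite_dimensional (maxprod_scale scaleX scaleY) K"
    and \<epsilon>: "\<epsilon> > 0"
  obtains L where "closed_subspace (maxprod_scale scaleX scaleY) L" "L \<subseteq> K"
    "infinite_dimensional (maxprod_scale scaleX scaleY) L"
    "\<And>p. p \<in> L \<Longrightarrow> norm (msnd p) \<le> \<epsilon> * norm (mfst p)"
proof -
  interpret X: normed_scaling scaleX by fact
  interpret Y: normed_scaling scaleY by fact
  interpret XY: normed_scaling "maxprod_scale scaleX scaleY"
    by (rule normed_scaling_maxprod) fact+
  have lin: "Vector_Spaces.linear scaleX scaleY A"
    using A by (simp add: strictly_singular_def bounded_operator_def)
  have bl: "bounded_linear A"
    using A X Y by (simp add: strictly_singular_def bounded_operator_imp_bounded_linear)
  have mem_graph: "p = MPair (mfst p) (A (mfst p))" if "p \<in> K" for p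
    using that K(2) by (auto simp: graph_def)
  \<comment> \<open>Projections need not preserve closedness, but here the image is the preimage of
    \<open>K\<close> under the graph map, which is continuous because \<open>A\<close> is
    bounded.\<close>
  have fst_K: "mfst ` K = {x. MPair x (A x) \<in> K}"
    using mem_graph by (force simp: image_iff)
  have Ks: "XY.subspace K" "closed K"
    using K(1) by (auto simp: closed_subspace_def)
  have "closed ((\<lambda>x. MPair x (A x)) -` K)"
    using bl Ks(2) by (intro closed_vimage linear_continuous_on bounded_linear_graph_map)
  then have "closed (mfst ` K)"
    by (simp add: fst_K vimage_def)
  moreover have "X.subspace (mfst ` K)"
    using module_hom.subspace_image[OF Vector_Spaces.linear.axioms(3)[OF linear_mfst[OF X Y]] Ks(1)] .
  ultimately have "closed_subspace scaleX (mfst ` K)"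
    by (simp add: closed_subspace_def)
  moreover have "infinite_dimensional scaleX (mfst ` K)"
  proof (rule infinite_dimensional_image[OF linear_graph_map[OF X Y lin]])
    show "infinite_dimensional (maxprod_scale scaleX scaleY) ((\<lambda>x. MPair x (A x)) ` mfst ` K)"
      using K(3) by (rule infinite_dimensional_mono) (use mem_graph in \<open>auto simp: image_iff\<close>)
  qed
  ultimately obtain L where L: "closed_subspace scaleX L" "infinite_dimensional scaleX L" "L \<subseteq> mfst ` K"
    "\<And>x. x \<in> L \<Longrightarrow> norm (A x) \<le> \<epsilon> * norm x"
    using strictly_singular_small_subspace[OF X Y A _ _ \<epsilon>] by metis
  let ?L = "{p \<in> K. mfst p \<in> L}"
  have "closed (K \<inter> mfst -` L)"
    using Ks(2) L(1) by (intro closed_Int closed_vimage continuous_on_mfst) (simp_all add: closed_subspace_def)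
  also have "K \<inter> mfst -` L = ?L" by auto
  finally have "closed_subspace (maxprod_scale scaleX scaleY) ?L"
    using Ks(1) L(1)
    by (auto simp: closed_subspace_def XY.subspace_def X.subspace_def plus_maxprod_def
        zero_maxprod_def maxprod_scale_def)
  moreover have "mfst ` ?L = L" using L(3) by auto
  then have "infinite_dimensional (maxprod_scale scaleX scaleY) ?L"
    using infinite_dimensional_image[OF linear_mfst[OF X Y], of ?L] L(2) by simp
  moreover have "norm (msnd p) \<le> \<epsilon> * norm (mfst p)" if "p \<in> ?L" for p
    using L(4)[of "mfst p"] mem_graph[of p] that by (metis (no_types, lifting) maxprod.sel(2) mem_Collect_eq)
  ultimately show ?thesis by (intro that[of ?L]) auto
qed

section \<open>Adjustment of the graphs with the graph of the null operator\<close>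

lemma ss_adjusted_strictly_singular_zero:
  fixes scaleX :: "'k :: {real_normed_field, euclidean_space} \<Rightarrow> 'x :: real_normed_vector \<Rightarrow> 'x"
    and scaleY :: "'k \<Rightarrow> 'y :: real_normed_vector \<Rightarrow> 'y"
  assumes X: "normed_scaling scaleX" and Y: "normed_scaling scaleY"
    and A: "\<And>n. n \<in> N \<Longrightarrow> strictly_singular scaleX scaleY (A n)"
  shows "ss_adjusted (maxprod_scale scaleX scaleY) N (\<lambda>n. graph (A n)) (\<lambda>n. graph (\<lambda>_. 0)) 0"
  unfolding ss_adjusted_def
proof (intro allI impI, elim conjE)
  fix N2 and K :: "nat \<Rightarrow> ('x, 'y) maxprod set"
  let ?s = "maxprod_scale scaleX scaleY"
  assume N2: "N2 \<subseteq> N" "infinite N2"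
    and K: "\<forall>n\<in>N2. closed_subspace ?s (K n) \<and> K n \<subseteq> graph (A n) \<and> infinite_dimensional ?s (K n)"
  \<comment> \<open>The tolerances tend to 0 along every infinite index set, so \<open>N2\<close>
    itself can serve as the required subset; \<open>Suc n\<close> keeps them positive at
    \<open>n = 0\<close>.\<close>
  have "\<exists>L. closed_subspace ?s L \<and> L \<subseteq> K n \<and> infinite_dimensional ?s L \<and>
      (\<forall>p\<in>L. norm (msnd p) \<le> inverse (real (Suc n)) * norm (mfst p))" if "n \<in> N2" for n
  proof -
    have n: "n \<in> N" and pos: "inverse (real (Suc n)) > 0"
      using that N2(1) by auto
    show ?thesis
      by (rule strictly_singular_graph_small_subspace[OF X Y A[OF n] _ _ _ pos])
        (use K that in blast)+
  qed
  then obtain L where L: "\<forall>n\<in>N2. closed_subspace ?s (L n) \<and> L n \<subseteq> K n \<and>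
      infinite_dimensional ?s (L n) \<and>
      (\<forall>p\<in>L n. norm (msnd p) \<le> inverse (real (Suc n)) * norm (mfst p))"
    using bchoice[of N2] by (metis (no_types, lifting))
  have "lower_uniformly_adjusted N2 L (\<lambda>n. graph (\<lambda>_. 0)) 0"
    unfolding lower_uniformly_adjusted_def
  proof (intro allI impI, elim conjE)
    fix \<eta> :: real and N3 and x :: "nat \<Rightarrow> ('x, 'y) maxprod"
    assume \<eta>: "\<eta> > 0" and N3: "N3 \<subseteq> N2" "infinite N3"
      and x: "\<forall>n\<in>N3. x n \<in> L n \<and> norm (x n) = 1"
    \<comment> \<open>With \<open>z = 0\<close>, the error \<open>x n - y n\<close> is just the
      second component of \<open>x n\<close>.\<close>
    define y :: "nat \<Rightarrow> ('x, 'y) maxprod" where "y n = MPair (mfst (x n)) 0" for n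
    have "norm (x n - y n - 0) \<le> inverse (real (Suc n))" if "n \<in> N3" for n
    proof -
      have "norm (mfst (x n)) \<le> 1"
        using x that by (auto simp: norm_maxprod_def)
      then have "inverse (real (Suc n)) * norm (mfst (x n)) \<le> inverse (real (Suc n)) * 1"
        by (intro mult_left_mono) auto
      moreover have "norm (msnd (x n)) \<le> inverse (real (Suc n)) * norm (mfst (x n))"
        using L x that N3(1) by blast
      ultimately have "norm (msnd (x n)) \<le> inverse (real (Suc n))" by linarith
      then show ?thesis
        by (simp add: y_def norm_maxprod_def minus_maxprod_def zero_maxprod_def)
    qed
    moreover have "\<forall>\<^sub>F n in sequentially. inverse (real (Suc n)) < \<eta>"
      using LIMSEQ_inverse_real_of_nat \<eta> by (rule order_tendstoD)
    ultimately have "\<forall>\<^sub>F n in inf sequentially (principal N3).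
        ereal (norm (x n - y n - 0)) \<le> ereal (0 + \<eta>)"
      unfolding eventually_inf_principal by (auto elim!: eventually_mono intro: order_trans less_imp_le)
    then have "limsup_on N3 (\<lambda>n. norm (x n - y n - 0)) \<le> ereal (0 + \<eta>)"
      unfolding limsup_on_def by (rule Limsup_bounded)
    moreover have "y n \<in> graph (\<lambda>_. 0)" for n
      by (auto simp: y_def graph_def)
    ultimately show "\<exists>N4 y z. N4 \<subseteq> N3 \<and> infinite N4 \<and> (\<forall>n\<in>N4. y n \<in> graph (\<lambda>_. 0)) \<and>
        limsup_on N4 (\<lambda>n. norm (x n - y n - z)) \<le> ereal (0 + \<eta>)"
      using N3(2) by blast
  qed
  then have "uniform_adjustment N2 L (\<lambda>n. graph (\<lambda>_. 0)) \<le> 0"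
    \<comment> \<open>0 belongs to the set of admissible values, which is bounded below by
      0.\<close>
    unfolding uniform_adjustment_def by (intro cInf_lower bdd_belowI[of _ 0]) auto
  with L N2(2) show "\<exists>N3 L. N3 \<subseteq> N2 \<and> infinite N3 \<and>
      (\<forall>n\<in>N3. closed_subspace ?s (L n) \<and> L n \<subseteq> K n \<and> infinite_dimensional ?s (L n)) \<and>
      uniform_adjustment N3 L (\<lambda>n. graph (\<lambda>_. 0)) \<le> 0"
    by blast
qed

theorem lemma3p4p3:
  fixes scaleX :: "'k :: {real_normed_field, euclidean_space} \<Rightarrow> 'x :: banach \<Rightarrow> 'x"
    and scaleY :: "'k \<Rightarrow> 'y :: banach \<Rightarrow> 'y"
    and N :: "nat set"
    and A :: "nat \<Rightarrow> 'x \<Rightarrow> 'y"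
  assumes "normed_scaling scaleX" and "normed_scaling scaleY"
    and "\<exists>x :: 'x. x \<noteq> 0"
    and "infinite N"
    and "\<And>n. n \<in> N \<Longrightarrow> strictly_singular scaleX scaleY (A n)"
  shows "ss_uniform_adjustment_op scaleX scaleY N A (\<lambda>_ _. 0) = 0"
  \<comment> \<open>The admissible values are nonnegative by definition, so 0 is their minimum once
    it is admissible.\<close>
  unfolding ss_uniform_adjustment_op_def ss_uniform_adjustment_def
  using ss_adjusted_strictly_singular_zero[OF assms(1,2,5)]
  by (intro cInf_eq_minimum) auto

end
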